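(* Let $n$ be a positive integer and let the edges of the complete graph $K_n$ be properly coloured using $n-1$ colours. Then this coloured $K_n$ contains at least $n/9-6$ pairwise edge-disjoint spanning rainbow trees.
   Context: An edge-colouring is proper if no two edges sharing a vertex have the same colour. A subgraph is rainbow if all its edges have different colours. A subgraph is spanning if it contains all vertices of the host graph. *)

theory Defs
  imports Complex_Main
begin

datatype 'a ugraph = UGraph (verts: "'a set") (edges: "'a set set")

definition simple_graph :: "'a ugraph \<Rightarrow> bool" where
  "simple_graph G \<longleftrightarrow>
     finite (verts G) \<and> (\<forall>e \<in> edges G. e \<subseteq> verts G \<and> card e = 2)"

definition complete_graph :: "nat \<Rightarrow> 'a ugraph \<Rightarrow> bool" where
  "complete_graph n G \<longleftrightarrow>
     simple_graph G \<and> card (verts G) = n \<and>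
     edges G = {e. e \<subseteq> verts G \<and> card e = 2}"

definition walk :: "'a ugraph \<Rightarrow> 'a list \<Rightarrow> bool" where
  "walk G xs \<longleftrightarrow>
     xs \<noteq> [] \<and> set xs \<subseteq> verts G \<and> successively (\<lambda>u v. {u, v} \<in> edges G) xs"

definition connected_graph :: "'a ugraph \<Rightarrow> bool" where
  "connected_graph G \<longleftrightarrow>
     verts G \<noteq> {} \<and>
     (\<forall>u \<in> verts G. \<forall>v \<in> verts G. \<exists>xs. walk G xs \<and> hd xs = u \<and> last xs = v)"

text \<open>A cycle is given by its list of vertices, the first vertex not being repeated at the end.\<close>

definition cycle :: "'a ugraph \<Rightarrow> 'a list \<Rightarrow> bool" where
  "cycle G xs \<longleftrightarrow>
     walk G xs \<and> distinct xs \<and> length xs \<ge> 3 \<and> {last xs, hd xs} \<in> edges G"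

definition tree :: "'a ugraph \<Rightarrow> bool" where
  "tree T \<longleftrightarrow> simple_graph T \<and> connected_graph T \<and> (\<nexists>xs. cycle T xs)"

definition subgraph :: "'a ugraph \<Rightarrow> 'a ugraph \<Rightarrow> bool" where
  "subgraph H G \<longleftrightarrow>
     simple_graph H \<and> simple_graph G \<and> verts H \<subseteq> verts G \<and> edges H \<subseteq> edges G"

definition spanning_subgraph :: "'a ugraph \<Rightarrow> 'a ugraph \<Rightarrow> bool" where
  "spanning_subgraph H G \<longleftrightarrow> subgraph H G \<and> verts H = verts G"

text \<open>The values of a colouring outside the edge set are irrelevant; the colours used are the
  elements of \<open>c ` edges G\<close>.\<close>

definition proper_edge_colouring :: "'a ugraph \<Rightarrow> ('a set \<Rightarrow> 'c) \<Rightarrow> bool" where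
  "proper_edge_colouring G c \<longleftrightarrow>
     (\<forall>e \<in> edges G. \<forall>f \<in> edges G. e \<noteq> f \<and> e \<inter> f \<noteq> {} \<longrightarrow> c e \<noteq> c f)"

definition rainbow :: "('a set \<Rightarrow> 'c) \<Rightarrow> 'a ugraph \<Rightarrow> bool" where
  "rainbow c H \<longleftrightarrow> inj_on c (edges H)"

definition edge_disjoint :: "'a ugraph \<Rightarrow> 'a ugraph \<Rightarrow> bool" where
  "edge_disjoint H K \<longleftrightarrow> edges H \<inter> edges K = {}"

end

theory Submission
  imports Defs "HOL-Combinatorics.Transposition"
begin

text \<open>Every vertex sees every colour, so the star at any vertex is a rainbow spanning tree. Fix
  \<open>t\<close> centres; their stars conflict only in the edges between centres. Treat the pairs of centres
  \<open>v i, v m\<close> with \<open>i < m\<close> one after the other, ordered by \<open>m\<close> and then by \<open>i\<close>: the tree at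
  \<open>v i\<close> keeps the edge \<open>v i v m\<close>. It gives up an edge \<open>v i u\<close>, by which the tree at \<open>v m\<close>
  reattaches \<open>v i\<close>. To stay rainbow, the tree at \<open>v m\<close> drops its edge \<open>v m w\<close> of the same
  colour and reattaches \<open>w\<close> by its edge of the colour of \<open>v i v m\<close>. The tree at \<open>v i\<close> drops one
  more edge \<open>v i y\<close> and reattaches \<open>u\<close> and \<open>y\<close> with the two lost colours exchanged.

  Both \<open>u\<close> and \<open>y\<close> are free. The conditions on \<open>u\<close> alone exclude at most about \<open>7t + i/2\<close>
  vertices, those on \<open>y\<close> given \<open>u\<close> at most about \<open>5t - i\<close>, and the remaining ones exclude at
  most about \<open>6t\<^sup>2\<close> pairs. With \<open>n \<ge> 9t + 46\<close> some pair \<open>(u, y)\<close> survives.\<close>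

section \<open>Trees given by parent functions\<close>

text \<open>This is the subtree hanging at \<open>w\<close>: the points from which repeated passage
  to the parent reaches \<open>w\<close>.\<close>

inductive_set below :: "('a \<Rightarrow> 'a) \<Rightarrow> 'a \<Rightarrow> 'a set" for p w where
  base: "w \<in> below p w"
| step: "p z \<in> below p w \<Longrightarrow> z \<in> below p w"

lemma below_cases: "z \<in> below p w \<longleftrightarrow> z = w \<or> p z \<in> below p w"
  by (auto intro: below.intros elim: below.cases)

lemma below_fixpoint:
  assumes "r \<in> below p w" "p r = r"
  shows "w = r"
proof -
  have "z \<in> below p w \<Longrightarrow> z = r \<Longrightarrow> w = r" for z
    by (induction rule: below.induct) (use assms(2) in auto)
  with assms(1) show ?thesis by blast
qed

lemma below_child_unique:
  assumes "s \<in> below p u" "s \<in> below p u'"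
    and "p u = r" "p u' = r" "p r = r" "u \<noteq> r" "u' \<noteq> r"
  shows "u = u'"
  using assms(1,2)
proof (induction rule: below.induct)
  case base
  then show ?case
    using assms(3-) below_cases[of u p u'] below_fixpoint[of r p u'] by auto
next
  case (step z)
  then show ?case
    using assms(3-) below_cases[of z p u'] below_fixpoint[of r p u] by auto
qed

text \<open>A new path to \<open>y\<close> that avoids \<open>u\<close> is an old path; one that
  meets \<open>u\<close> starts with an old path to \<open>u\<close>.\<close>

lemma below_upd: "below (p(u := x)) y \<subseteq> below p y \<union> below p u"
proof
  fix z assume "z \<in> below (p(u := x)) y"
  then show "z \<in> below p y \<union> below p u"
  proof (induction rule: below.induct)
    case base
    show ?case by (auto intro: below.intros)
  next
    case (step z)
    then show ?case by (cases "z = u") (auto intro: below.intros)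
  qed
qed

lemma below_funpow: "z \<in> below p w \<Longrightarrow> \<exists>k. (p ^^ k) z = w"
proof (induction rule: below.induct)
  case base
  show ?case by (rule exI[of _ 0]) simp
next
  case (step z)
  then obtain k where "(p ^^ k) (p z) = w" by blast
  then show ?case by (intro exI[of _ "Suc k"]) (simp add: funpow_swap1)
qed

text \<open>A spanning tree of \<open>V\<close> is encoded by its parent function, with the root as
  its own parent. Each edge is indexed by its lower end, so that exchanging an edge is a function
  update.\<close>

definition rooted :: "'a set \<Rightarrow> 'a \<Rightarrow> ('a \<Rightarrow> 'a) \<Rightarrow> bool" where
  "rooted V r p \<longleftrightarrow> r \<in> V \<and> p r = r \<and> p ` V \<subseteq> V \<and> V \<subseteq> below p r"

text \<open>Paths to the root from outside the subtree at \<open>w\<close> avoid \<open>w\<close>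
  and survive. One of them starts at \<open>x\<close>, so paths that meet \<open>w\<close> can
  continue through \<open>x\<close>.\<close>

lemma rooted_upd:
  assumes "rooted V r p" "w \<in> V" "w \<noteq> r" "x \<in> V" "x \<notin> below p w"
  shows "rooted V r (p(w := x))"
proof -
  let ?p = "p(w := x)"
  have *: "z \<in> below p r \<Longrightarrow> z \<notin> below p w \<Longrightarrow> z \<in> below ?p r" for z
  proof (induction rule: below.induct)
    case base
    show ?case by (rule below.base)
  next
    case (step z)
    then have "z \<noteq> w" "p z \<notin> below p w" by (auto intro: below.intros)
    with step show ?case by (auto intro: below.step)
  qed
  have x: "x \<in> below ?p r"
    using assms * by (auto simp: rooted_def)
  have "z \<in> below p r \<Longrightarrow> z \<in> below ?p r" for z
  proof (induction rule: below.induct)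
    case base
    show ?case by (rule below.base)
  next
    case (step z)
    have "?p z = (if z = w then x else p z)" by simp
    with x step.IH have "?p z \<in> below ?p r" by presburger
    then show ?case by (rule below.step)
  qed
  then show ?thesis using assms by (auto simp: rooted_def)
qed

text \<open>The number of parent steps to the root serves as rank; it rules out loops and
  cycles.\<close>

lemma rooted_rank:
  assumes "rooted V r p"
  shows "\<exists>d :: 'a \<Rightarrow> nat. \<forall>z\<in>V - {r}. d (p z) < d z"
proof (intro exI ballI)
  let ?d = "\<lambda>z. LEAST k. (p ^^ k) z = r"
  fix z assume z: "z \<in> V - {r}"
  then have "\<exists>k. (p ^^ k) z = r"
    using assms below_funpow[of z p r] by (auto simp: rooted_def)
  then have k: "(p ^^ ?d z) z = r" by (rule LeastI_ex)
  with z have "?d z \<noteq> 0" by (metis DiffD2 funpow_0 singletonI)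
  then obtain j where j: "?d z = Suc j" using not0_implies_Suc by blast
  with k have "(p ^^ j) (p z) = r" by (simp add: funpow_swap1)
  then have "?d (p z) \<le> j" by (rule Least_le)
  with j show "?d (p z) < ?d z" by simp
qed

section \<open>From parent functions to trees\<close>

definition tree_edges :: "'a set \<Rightarrow> 'a \<Rightarrow> ('a \<Rightarrow> 'a) \<Rightarrow> 'a set set" where
  "tree_edges V r p = (\<lambda>z. {z, p z}) ` (V - {r})"

lemma rooted_parent_neq:
  assumes "rooted V r p" "z \<in> V - {r}"
  shows "p z \<noteq> z"
  using rooted_rank[OF assms(1)] assms(2) by force

lemma tree_edges_simple:
  assumes "rooted V r p" "finite V"
  shows "simple_graph (UGraph V (tree_edges V r p))"
proof -
  have "card {z, p z} = 2" if "z \<in> V - {r}" for z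
    using rooted_parent_neq[OF assms(1) that] by simp
  then show ?thesis
    using assms by (auto simp: simple_graph_def tree_edges_def rooted_def)
qed

lemma walk_of_rtranclp:
  assumes "(\<lambda>a b. {a, b} \<in> edges G \<and> a \<in> verts G \<and> b \<in> verts G)\<^sup>*\<^sup>* a b" "b \<in> verts G"
  shows "\<exists>xs. walk G xs \<and> hd xs = a \<and> last xs = b"
  using assms
proof (induction rule: converse_rtranclp_induct)
  case base
  then show ?case by (intro exI[of _ "[b]"]) (simp add: walk_def)
next
  case (step y z)
  then obtain xs where "walk G xs" "hd xs = z" "last xs = b" by blast
  with step show ?case
    by (intro exI[of _ "y # xs"]) (cases xs; auto simp: walk_def)
qed

lemma tree_edges_connected:
  assumes "rooted V r p"
  shows "connected_graph (UGraph V (tree_edges V r p))"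
proof -
  let ?G = "UGraph V (tree_edges V r p)"
  let ?R = "\<lambda>a b. {a, b} \<in> edges ?G \<and> a \<in> verts ?G \<and> b \<in> verts ?G"
  have to_root: "z \<in> below p r \<Longrightarrow> z \<in> V \<Longrightarrow> ?R\<^sup>*\<^sup>* z r" for z
  proof (induction rule: below.induct)
    case base
    show ?case by simp
  next
    case (step z)
    show ?case
    proof (cases "z = r")
      case False
      with step assms have "?R z (p z)" by (auto simp: tree_edges_def rooted_def)
      with step show ?thesis by (auto intro: converse_rtranclp_into_rtranclp)
    qed simp
  qed
  have "symp ?R" by (auto simp: symp_def insert_commute)
  then have "symp ?R\<^sup>*\<^sup>*" by (rule symp_rtranclp)
  have "?R\<^sup>*\<^sup>* a b" if "a \<in> V" "b \<in> V" for a b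
  proof -
    have "?R\<^sup>*\<^sup>* a r" "?R\<^sup>*\<^sup>* b r"
      using that to_root assms unfolding rooted_def by blast+
    with sympD[OF \<open>symp ?R\<^sup>*\<^sup>*\<close>] show ?thesis
      by (blast intro: rtranclp_trans)
  qed
  then show ?thesis
    using assms walk_of_rtranclp[of ?G] by (auto simp: connected_graph_def rooted_def)
qed

text \<open>On a cycle, both neighbours of a vertex of maximal rank would have to be its parent.\<close>

lemma tree_edges_acyclic:
  assumes "rooted V r p"
  shows "\<nexists>xs. cycle (UGraph V (tree_edges V r p)) xs"
proof
  assume "\<exists>xs. cycle (UGraph V (tree_edges V r p)) xs"
  then obtain xs where xs: "distinct xs" "length xs \<ge> 3"
    and adj: "successively (\<lambda>u v. {u, v} \<in> tree_edges V r p) xs"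
    and close: "{last xs, hd xs} \<in> tree_edges V r p"
    by (auto simp: cycle_def walk_def)
  obtain d :: "'a \<Rightarrow> nat" where d: "\<And>z. z \<in> V - {r} \<Longrightarrow> d (p z) < d z"
    using rooted_rank[OF assms] by blast
  let ?n = "length xs"
  have next_edge: "{xs ! j, xs ! (Suc j mod ?n)} \<in> tree_edges V r p" if "j < ?n" for j
  proof (cases "Suc j < ?n")
    case True
    then show ?thesis using adj by (simp add: successively_conv_nth)
  next
    case False
    with that have "Suc j = ?n" by simp
    moreover have "xs \<noteq> []" using that by auto
    moreover have "j = ?n - 1" using \<open>Suc j = ?n\<close> by simp
    ultimately have "xs ! j = last xs" "xs ! (Suc j mod ?n) = hd xs"
      by (simp_all add: last_conv_nth hd_conv_nth)
    then show ?thesis using close by simp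
  qed
  have parent: "b = p a" if "{a, b} \<in> tree_edges V r p" "d b \<le> d a" for a b
  proof -
    from that(1) obtain z where z: "z \<in> V - {r}" "{a, b} = {z, p z}"
      by (auto simp: tree_edges_def)
    with d[OF z(1)] that(2) show ?thesis by (auto simp: doubleton_eq_iff)
  qed
  have "\<exists>j<?n. \<forall>l<?n. d (xs ! l) \<le> d (xs ! j)"
  proof -
    have "finite ((\<lambda>j. d (xs ! j)) ` {..<?n})" "(\<lambda>j. d (xs ! j)) ` {..<?n} \<noteq> {}"
      using xs by (auto simp: lessThan_empty_iff)
    from Max_in[OF this] Max_ge[OF this(1)] show ?thesis by fastforce
  qed
  then obtain j where j: "j < ?n" "\<And>l. l < ?n \<Longrightarrow> d (xs ! l) \<le> d (xs ! j)" by blast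
  \<comment> \<open>\<open>a\<close> and \<open>b\<close> are the cyclic successor and predecessor
    of \<open>j\<close>; they differ because the cycle has at least three vertices.\<close>
  define a where "a = Suc j mod ?n"
  define b where "b = (if j = 0 then ?n - 1 else j - 1)"
  have ab: "a < ?n" "b < ?n" "Suc b mod ?n = j"
    using j(1) xs(2) by (auto simp: a_def b_def intro: mod_less_divisor)
  have "a \<noteq> b"
  proof (cases "Suc j < ?n")
    case True
    then show ?thesis using xs(2) by (auto simp: a_def b_def)
  next
    case False
    with j(1) have "Suc j = ?n" by simp
    then have "a = 0" by (simp add: a_def)
    then show ?thesis using xs(2) \<open>Suc j = ?n\<close> by (auto simp: b_def)
  qed
  moreover have "xs ! a = p (xs ! j)"
    using parent[OF next_edge[OF j(1)]] j(2)[OF ab(1)] by (simp add: a_def)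
  moreover have "xs ! b = p (xs ! j)"
    using parent[of "xs ! j" "xs ! b"] next_edge[OF ab(2)] j(2)[OF ab(2)] ab(3)
    by (simp add: insert_commute)
  ultimately show False using xs(1) ab by (metis nth_eq_iff_index_eq)
qed

lemma tree_edges_tree:
  assumes "rooted V r p" "finite V"
  shows "tree (UGraph V (tree_edges V r p))"
  using tree_edges_simple[OF assms] tree_edges_connected[OF assms(1)]
    tree_edges_acyclic[OF assms(1)] by (simp add: tree_def)

section \<open>Switching edges between two trees\<close>

text \<open>\<open>nb a x\<close> is the neighbour of \<open>x\<close> along the edge of colour \<open>a\<close>.\<close>

locale factorization =
  fixes V :: "'a set" and f :: "'a \<Rightarrow> 'a \<Rightarrow> 'c" and S :: "'c set" and nb :: "'c \<Rightarrow> 'a \<Rightarrow> 'a"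
  assumes finite_V: "finite V"
    and f_sym: "f x y = f y x"
    and f_in: "x \<in> V \<Longrightarrow> y \<in> V \<Longrightarrow> x \<noteq> y \<Longrightarrow> f x y \<in> S"
    and nb_in: "a \<in> S \<Longrightarrow> x \<in> V \<Longrightarrow> nb a x \<in> V"
    and nb_neq: "a \<in> S \<Longrightarrow> x \<in> V \<Longrightarrow> nb a x \<noteq> x"
    and f_nb: "a \<in> S \<Longrightarrow> x \<in> V \<Longrightarrow> f x (nb a x) = a"
    and nb_f: "x \<in> V \<Longrightarrow> y \<in> V \<Longrightarrow> x \<noteq> y \<Longrightarrow> nb (f x y) x = y"
begin

lemma nb_nb: "a \<in> S \<Longrightarrow> x \<in> V \<Longrightarrow> nb a (nb a x) = x"
  by (metis f_nb f_sym nb_f nb_in nb_neq)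

lemma f_inj: "f x y = f x z \<Longrightarrow> x \<in> V \<Longrightarrow> y \<in> V \<Longrightarrow> z \<in> V \<Longrightarrow> x \<noteq> y \<Longrightarrow> x \<noteq> z \<Longrightarrow> y = z"
  by (metis nb_f)

definition rainbow_rooted :: "'a \<Rightarrow> ('a \<Rightarrow> 'a) \<Rightarrow> bool" where
  "rainbow_rooted r p \<longleftrightarrow> rooted V r p \<and> inj_on (\<lambda>z. f z (p z)) (V - {r})"

text \<open>The two new edges exchange the colours of the two old ones.\<close>

lemma rainbow_rooted_switch:
  assumes "rainbow_rooted r p"
    and s: "s1 \<in> V" "s2 \<in> V" "s1 \<noteq> r" "s2 \<noteq> r" "s1 \<noteq> s2" "p s1 = r" "p s2 = r"
    and q: "q1 \<in> V" "q2 \<in> V" "q1 \<notin> below p s1" "q2 \<notin> below p s1" "q2 \<notin> below p s2"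
    and f: "f s1 q1 = f r s2" "f s2 q2 = f r s1"
  shows "rainbow_rooted r (p(s1 := q1, s2 := q2))"
proof -
  let ?p = "p(s1 := q1, s2 := q2)"
  let ?g = "\<lambda>z. f z (p z)"
  have p: "rooted V r p" "inj_on ?g (V - {r})" using assms(1) by (auto simp: rainbow_rooted_def)
  \<comment> \<open>The parents are changed one at a time. After the first change the subtree at
    \<open>s2\<close> may have grown by vertices from the subtree at \<open>s1\<close>, so
    \<open>q2\<close> has to avoid both old subtrees.\<close>
  have "rooted V r (p(s1 := q1))" using rooted_upd[OF p(1)] s q by blast
  then have "rooted V r ?p"
    using rooted_upd[of V r "p(s1 := q1)" s2 q2] below_upd[of p s1 q1 s2] s q by blast
  moreover have "f z (?p z) = ?g (Transposition.transpose s1 s2 z)" for z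
    using s f f_sym by (auto simp: Transposition.transpose_def)
  moreover have "inj_on (\<lambda>z. ?g (Transposition.transpose s1 s2 z)) (V - {r})"
  proof (rule inj_onI)
    fix x y assume xy: "x \<in> V - {r}" "y \<in> V - {r}"
      "?g (Transposition.transpose s1 s2 x) = ?g (Transposition.transpose s1 s2 y)"
    have "Transposition.transpose s1 s2 z \<in> V - {r}" if "z \<in> V - {r}" for z
      using that s by (auto simp: Transposition.transpose_def)
    with xy inj_onD[OF p(2)] show "x = y" by (metis transpose_involutory)
  qed
  ultimately show ?thesis by (simp add: rainbow_rooted_def)
qed

end

section \<open>The invariant for partially separated stars\<close>

locale centres = factorization V f S nb
  for V :: "'a set" and f :: "'a \<Rightarrow> 'a \<Rightarrow> 'c" and S :: "'c set" and nb :: "'c \<Rightarrow> 'a \<Rightarrow> 'a" +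
  fixes v :: "nat \<Rightarrow> 'a" and t :: nat
  assumes v_inj: "inj_on v {..<t}" and v_in: "v ` {..<t} \<subseteq> V"
begin

abbreviation C :: "'a set" where "C \<equiv> v ` {..<t}"

text \<open>The edge from a moved vertex to its parent is an outer edge. Centres are left out
  because \<open>packing\<close> controls their parents by separate clauses.\<close>

definition moved :: "(nat \<Rightarrow> 'a \<Rightarrow> 'a) \<Rightarrow> nat \<Rightarrow> 'a set" where
  "moved p k = {z \<in> V - C. p k z \<noteq> v k}"

text \<open>A switch at \<open>(l, k)\<close> with \<open>l < k\<close> moves one vertex of the tree
  at \<open>v k\<close> and two of the tree at \<open>v l\<close>. For \<open>k < m\<close> the
  completed rounds contribute \<open>k + 2 * (m - 1 - k)\<close>; the other two terms come from the
  current round.\<close>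

definition moved_bound :: "nat \<Rightarrow> nat \<Rightarrow> nat \<Rightarrow> nat" where
  "moved_bound m i k = (if k < m then 2 * m - 2 - k else 0) + (if k < i then 2 else 0) + (if k = m then i else 0)"

text \<open>The state in which all pairs of centres with larger index below \<open>m\<close>, and the pairs
  \<open>(l, m)\<close> with \<open>l < i\<close>, have been treated. The tree at \<open>v l\<close> keeps the edge to \<open>v k\<close> for
  \<open>l < k\<close>; the tree at \<open>v k\<close> gets in exchange an edge at \<open>v l\<close> that the tree at \<open>v l\<close> has
  given up. The injectivity clause says that no such edge is given away twice.\<close>

definition packing :: "(nat \<Rightarrow> 'a \<Rightarrow> 'a) \<Rightarrow> nat \<Rightarrow> nat \<Rightarrow> bool" where
  "packing p m i \<longleftrightarrow>
     (\<forall>k<t. rainbow_rooted (v k) (p k)) \<and>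
     (\<forall>k<t. card (moved p k) \<le> moved_bound m i k) \<and>
     (\<forall>k<t. p k ` moved p k \<subseteq> V - C) \<and>
     (\<forall>k<t. \<forall>l<t. l < k \<and> (k < m \<or> k = m \<and> l < i) \<longrightarrow> p k (v l) \<in> moved p l) \<and>
     (\<forall>k<t. \<forall>l<t. \<not> (l < k \<and> (k < m \<or> k = m \<and> l < i)) \<longrightarrow> p k (v l) = v k) \<and>
     (\<forall>l<t. inj_on (\<lambda>k. p k (v l)) {..<t}) \<and>
     (\<forall>k<t. \<forall>k'<t. k \<noteq> k' \<longrightarrow> (\<forall>z \<in> moved p k. \<forall>z' \<in> moved p k'. {z, p k z} \<noteq> {z', p k' z'}))"

lemma C_in: "k < t \<Longrightarrow> v k \<in> C" by blast

lemma C_V: "k < t \<Longrightarrow> v k \<in> V" using v_in by blast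

lemma finite_moved: "finite (moved p k)" by (simp add: moved_def finite_V)

text \<open>The data of the switch at a pair \<open>i < m\<close>: \<open>u\<close> and \<open>y\<close> are chosen freely, and
  \<open>w\<close>, \<open>x\<close>, \<open>x'\<close>, \<open>z\<close> are then forced by the colours.\<close>

definition switch :: "(nat \<Rightarrow> 'a \<Rightarrow> 'a) \<Rightarrow> nat \<Rightarrow> nat \<Rightarrow> 'a \<Rightarrow> 'a \<Rightarrow> 'a \<Rightarrow> 'a \<Rightarrow> 'a \<Rightarrow> 'a \<Rightarrow> bool" where
  "switch p m i u w x y x' z \<longleftrightarrow>
     {u, w, x, y, x', z} \<subseteq> V - C \<and> u \<notin> moved p i \<and> y \<notin> moved p i \<and> w \<notin> moved p m \<and>
     f (v i) u = f (v m) w \<and> f w x = f (v i) (v m) \<and>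
     f u x' = f (v i) y \<and> f y z = f (v i) u \<and>
     x \<notin> below (p m) w \<and> x' \<notin> below (p i) u \<and> z \<notin> below (p i) y \<and> z \<notin> below (p i) u \<and>
     (\<forall>k<t. k \<noteq> m \<longrightarrow> (\<forall>l \<in> moved p k. {w, x} \<noteq> {l, p k l})) \<and>
     (\<forall>k<t. k \<noteq> i \<longrightarrow> (\<forall>l \<in> moved p k. {u, x'} \<noteq> {l, p k l} \<and> {y, z} \<noteq> {l, p k l}))"

lemma packing_dest:
  assumes "packing p m i"
  shows "\<forall>k<t. rainbow_rooted (v k) (p k)"
    "\<forall>k<t. card (moved p k) \<le> moved_bound m i k"
    "\<forall>k<t. p k ` moved p k \<subseteq> V - C"
    "\<forall>k<t. \<forall>l<t. l < k \<and> (k < m \<or> k = m \<and> l < i) \<longrightarrow> p k (v l) \<in> moved p l"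
    "\<forall>k<t. \<forall>l<t. \<not> (l < k \<and> (k < m \<or> k = m \<and> l < i)) \<longrightarrow> p k (v l) = v k"
    "\<forall>l<t. inj_on (\<lambda>k. p k (v l)) {..<t}"
    "\<forall>k<t. \<forall>k'<t. k \<noteq> k' \<longrightarrow> (\<forall>z \<in> moved p k. \<forall>z' \<in> moved p k'. {z, p k z} \<noteq> {z', p k' z'})"
  by (insert assms[unfolded packing_def], elim conjE, assumption)+

text \<open>A centre is attached either to the root or to a moved vertex, which is not a centre;
  parents of moved vertices are not centres either.\<close>

lemma parent_in_C:
  assumes "packing p m i" "k < t" "z \<in> V" "p k z \<in> C"
  shows "p k z = v k"
proof (cases "z \<in> C")
  case True
  then obtain l where l: "l < t" "z = v l" by blast
  have "p k (v l) \<notin> moved p l" using assms(4) l by (simp add: moved_def)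
  moreover have "p k (v l) \<in> moved p l \<or> p k (v l) = v k"
    using packing_dest(4,5)[OF assms(1)] assms(2) l(1) by metis
  ultimately show ?thesis using l by simp
next
  case False
  have "p k ` moved p k \<subseteq> V - C" using packing_dest(3)[OF assms(1)] assms(2) by simp
  with False show ?thesis using assms(3,4) by (auto simp: moved_def)
qed

text \<open>Both changes are instances of \<open>rainbow_rooted_switch\<close>: the root children
  \<open>v i\<close> and \<open>w\<close> exchange colours in the tree at \<open>v m\<close>, and so
  do \<open>u\<close> and \<open>y\<close> in the tree at \<open>v i\<close>.\<close>

lemma packing_switch:
  assumes inv: "packing p m i" and im: "i < m" "m < t"
    and sw: "switch p m i u w x y x' z"
  shows "\<exists>p'. packing p' m (Suc i)"
proof
  define p' where "p' = p(m := (p m)(v i := u, w := x), i := (p i)(u := x', y := z))"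
  have it: "i < t" using im by simp
  note I = packing_dest[OF inv]
  note W = sw[unfolded switch_def]
  have V: "u \<in> V" "w \<in> V" "x \<in> V" "y \<in> V" "x' \<in> V" "z \<in> V"
    and nC: "u \<notin> C" "w \<notin> C" "x \<notin> C" "y \<notin> C" "x' \<notin> C" "z \<notin> C" using W by auto
  have nv: "v l \<noteq> u" "v l \<noteq> w" "v l \<noteq> x" "v l \<noteq> y" "v l \<noteq> x'" "v l \<noteq> z" if "l < t" for l
    using nC C_in[OF that] by auto
  have v_eq: "v k = v l \<longleftrightarrow> k = l" if "k < t" "l < t" for k l
    using v_inj that by (auto simp: inj_on_def)
  have p'm: "p' m = (p m)(v i := u, w := x)" and p'i: "p' i = (p i)(u := x', y := z)"
    and p'o: "k \<noteq> m \<Longrightarrow> k \<noteq> i \<Longrightarrow> p' k = p k" for k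
    using im by (auto simp: p'_def)
  have pu: "p i u = v i" "p i y = v i" "p m w = v m" using W V nC by (auto simp: moved_def)
  have pmi: "p m (v i) = v m" "p i (v m) = v i" using I(5) im it by auto
  have uy: "u \<noteq> y"
  proof
    assume "u = y"
    then have "f u x' = f u (v i)" using W f_sym[of "v i" u] by simp
    moreover have "u \<noteq> x'" using W by (auto intro: below.base)
    ultimately show False using f_inj[of u x' "v i"] V C_V[OF it] nv[OF it] by auto
  qed
  have Lm: "moved p' m = insert w (moved p m)"
    using im V nC nv[OF im(2)] nv[OF it] C_in[OF it] by (auto simp: moved_def p'm)
  have Li: "moved p' i = insert u (insert y (moved p i))"
    using im V nC nv[OF it] by (auto simp: moved_def p'i)
  have Lo: "k \<noteq> m \<Longrightarrow> k \<noteq> i \<Longrightarrow> moved p' k = moved p k" for k by (simp add: moved_def p'o)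
  have L_sub: "moved p k \<subseteq> moved p' k" for k
  proof
    fix a assume "a \<in> moved p k"
    then show "a \<in> moved p' k" using Lm Li Lo[of k] by blast
  qed
  \<comment> \<open>\<open>v i\<close> is a leaf of the tree at \<open>v m\<close>, so neither
    \<open>u\<close> nor \<open>x\<close> can lie in its subtree.\<close>
  have below_vi: "a = v i" if "a \<in> below (p m) (v i)" "a \<in> V" for a
    using that
  proof (induction rule: below.induct)
    case base show ?case ..
  next
    case (step a)
    have "p m a \<in> V" using I(1) im(2) step.prems by (auto simp: rainbow_rooted_def rooted_def)
    with step have "p m a = v i" by blast
    with parent_in_C[OF inv im(2) step.prems] C_in[OF it] have "v i = v m" by simp
    then show ?case using v_eq im it by auto
  qed
  have r: "rainbow_rooted (v k) (p' k)" if "k < t" for k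
  proof -
    consider "k = m" | "k = i" | "k \<noteq> m" "k \<noteq> i" by blast
    then show ?thesis
    proof cases
      case 1
      have "rainbow_rooted (v m) ((p m)(v i := u, w := x))"
        using below_vi[of u] below_vi[of x] I(1) im V C_V[OF it] nv[OF it] nv[OF im(2)] v_eq[OF it im(2)] pu pmi W f_sym
        by (intro rainbow_rooted_switch) (auto)
      then show ?thesis using 1 p'm by simp
    next
      case 2
      have "rainbow_rooted (v i) ((p i)(u := x', y := z))"
        using I(1) it V nv[OF it] pu uy W f_sym
        by (intro rainbow_rooted_switch) auto
      then show ?thesis using 2 p'i by simp
    next
      case 3
      then show ?thesis using I(1) that p'o by auto
    qed
  qed
  have crd: "card (moved p' k) \<le> moved_bound m (Suc i) k" if "k < t" for k
  proof -
    consider "k = m" | "k = i" | "k \<noteq> m" "k \<noteq> i" by blast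
    then show ?thesis
    proof cases
      case 1
      then have "card (moved p k) \<le> moved_bound m i m" using I(2) im by auto
      moreover have "card (moved p' k) \<le> Suc (card (moved p k))"
        using 1 Lm card_insert_le_m1 by (simp add: card_insert_if finite_moved)
      ultimately show ?thesis using 1 im by (simp add: moved_bound_def)
    next
      case 2
      then have "card (moved p k) \<le> moved_bound m i i" using I(2) it by auto
      moreover have "card (moved p' k) \<le> Suc (Suc (card (moved p k)))"
        using 2 Li by (simp add: card_insert_if finite_moved)
      ultimately show ?thesis using 2 im by (simp add: moved_bound_def)
    next
      case 3
      then have "card (moved p' k) \<le> moved_bound m i k" using I(2) that Lo by auto
      then show ?thesis using 3 by (auto simp: moved_bound_def split: if_splits)
    qed
  qed
  have out: "p' k ` moved p' k \<subseteq> V - C" if "k < t" for k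
  proof -
    have *: "p k ` moved p k \<subseteq> V - C" using I(3) that by simp
    consider "k = m" | "k = i" | "k \<noteq> m" "k \<noteq> i" by blast
    then show ?thesis
    proof cases
      case 1
      then show ?thesis using * Lm V nC C_in[OF it] by (auto simp: p'm moved_def)
    next
      case 2
      then show ?thesis using * Li V nC by (auto simp: p'i)
    next
      case 3
      then show ?thesis using * Lo p'o by auto
    qed
  qed
  have pv: "p' k (v l) = (if k = m \<and> l = i then u else p k (v l))" if "k < t" "l < t" for k l
    using that nv[OF that(2)] v_eq[OF that(2) it] im by (auto simp: p'_def)
  have c1: "p' k (v l) \<in> moved p' l"
    if "k < t" "l < t" "l < k \<and> (k < m \<or> k = m \<and> l < Suc i)" for k l
  proof (cases "k = m \<and> l = i")
    case True
    then show ?thesis using pv that Li by auto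
  next
    case False
    then have "p k (v l) \<in> moved p l" using that I by auto
    then show ?thesis using pv[OF that(1,2)] False L_sub by auto
  qed
  have c2: "p' k (v l) = v k"
    if "k < t" "l < t" "\<not> (l < k \<and> (k < m \<or> k = m \<and> l < Suc i))" for k l
    using I(5) that pv[OF that(1,2)] im by auto
  have c3: "inj_on (\<lambda>k. p' k (v l)) {..<t}" if "l < t" for l
  proof (cases "l = i")
    case False
    then have "inj_on (\<lambda>k. p' k (v l)) {..<t} \<longleftrightarrow> inj_on (\<lambda>k. p k (v l)) {..<t}"
      using pv that by (intro inj_on_cong) auto
    then show ?thesis using I(6) that by simp
  next
    case True
    \<comment> \<open>The old parents of \<open>v i\<close> are moved vertices of its own tree or
      centres, and \<open>u\<close> is neither.\<close>
    have "p k (v i) \<noteq> u" if "k < t" for k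
    proof (cases "i < k \<and> k < m")
      case True
      then have "p k (v i) \<in> moved p i" using I(4) that it by auto
      then show ?thesis using W by auto
    next
      case False
      then have "p k (v i) = v k" using I(5) that it by auto
      then show ?thesis using nv that by simp
    qed
    moreover have "inj_on (\<lambda>k. p k (v i)) {..<t}" using I(6) it by simp
    ultimately show ?thesis
      using pv it unfolding inj_on_def True by (metis lessThan_iff)
  qed
  have col_i: "f (v i) y \<noteq> f (v i) (v m)" "f (v i) u \<noteq> f (v i) (v m)"
    using f_inj[of "v i" y "v m"] f_inj[of "v i" u "v m"] V C_V[OF it] C_V[OF im(2)]
      nv[OF it] nv[OF im(2)] v_eq[OF it im(2)] im by auto
  have f_doubleton: "f a b = f a' b'" if "{a, b} = {a', b'}" for a b a' b'
    using that f_sym by (auto simp: doubleton_eq_iff)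
  \<comment> \<open>The edge \<open>{w, x}\<close> has the colour of \<open>{v i, v m}\<close>,
    whereas the other two have colours of different edges at \<open>v i\<close>.\<close>
  have new: "{w, x} \<noteq> {u, x'}" "{w, x} \<noteq> {y, z}"
    using f_doubleton[of w x u x'] f_doubleton[of w x y z] col_i W by auto
  have edge: "a \<in> moved p k \<and> p' k a = p k a \<or> k = m \<and> {a, p' k a} = {w, x}
      \<or> k = i \<and> ({a, p' k a} = {u, x'} \<or> {a, p' k a} = {y, z})"
    if "k < t" "a \<in> moved p' k" for k a
  proof -
    consider "k = m" | "k = i" | "k \<noteq> m" "k \<noteq> i" by blast
    then show ?thesis
    proof cases
      case 1
      then show ?thesis using that Lm C_in[OF it] by (auto simp: p'm moved_def)
    next
      case 2
      then show ?thesis using that Li im uy by (auto simp: p'i)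
    next
      case 3
      then show ?thesis using that Lo p'o by auto
    qed
  qed
  have disj: "{a, p' k a} \<noteq> {a', p' k' a'}"
    if "k < t" "k' < t" "k \<noteq> k'" "a \<in> moved p' k" "a' \<in> moved p' k'" for k k' a a'
  proof -
    have "\<forall>a \<in> moved p k. \<forall>a' \<in> moved p k'. {a, p k a} \<noteq> {a', p k' a'}" using I(7) that by simp
    moreover have "\<forall>k<t. k \<noteq> m \<longrightarrow> (\<forall>l \<in> moved p k. {w, x} \<noteq> {l, p k l})"
      "\<forall>k<t. k \<noteq> i \<longrightarrow> (\<forall>l \<in> moved p k. {u, x'} \<noteq> {l, p k l} \<and> {y, z} \<noteq> {l, p k l})"
      using W by blast+
    ultimately show ?thesis
      using edge[OF that(1,4)] edge[OF that(2,5)] new that(1-3) by metis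
  qed
  show "packing p' m (Suc i)"
    unfolding packing_def
    by (intro conjI allI impI ballI) (rule r crd out c1 c2 c3 disj; assumption)+
qed


section \<open>Existence of a switch\<close>

text \<open>This bounds the total number of outer edges. Both sides are doubled because of the half
  in the arithmetic series.\<close>

lemma sum_moved_bound:
  assumes "i \<le> m" "m \<le> t" "0 < m"
  shows "2 * (\<Sum>k<t. moved_bound m i k) \<le> 3 * m * (m - 1) + 6 * i"
proof -
  have 1: "j \<le> m \<Longrightarrow> 2 * (\<Sum>k<j. 2 * m - 2 - k) + j * j = j * (4 * m - 3)" for j
  proof (induction j)
    case (Suc j)
    then obtain d where d: "m = Suc (j + d)" by (auto simp: Suc_le_eq less_iff_Suc_add)
    have "2 * (\<Sum>k<j. 2 * m - 2 - k) + j * j = j * (4 * m - 3)" using Suc by simp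
    moreover have "2 * m - 2 - j = j + 2 * d" "4 * m - 3 = 4 * j + 4 * d + 1" using d by simp_all
    ultimately show ?case by (simp only: d sum.lessThan_Suc) (simp add: algebra_simps)
  qed simp
  have "(\<Sum>k<t. if k < m then 2 * m - 2 - k else 0) = (\<Sum>k<m. 2 * m - 2 - k)"
    using assms by (intro sum.mono_neutral_cong_right) auto
  moreover have "(\<Sum>k<t. if k < i then 2 else 0) = (\<Sum>k<i. 2 :: nat)"
    using assms by (intro sum.mono_neutral_cong_right) auto
  moreover have "(\<Sum>k<t. if k = m then i else 0) \<le> i"
    by (simp add: sum.delta')
  ultimately have "(\<Sum>k<t. moved_bound m i k) \<le> (\<Sum>k<m. 2 * m - 2 - k) + 3 * i"
    by (simp add: moved_bound_def sum.distrib)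
  moreover have "m * (4 * m - 3) = 3 * m * (m - 1) + m * m"
    using assms(3) by (cases m) (auto simp: algebra_simps)
  ultimately show ?thesis using 1[of m] by simp
qed

text \<open>If the \<open>b\<close>-neighbour \<open>x\<close> of \<open>w\<close> lies below \<open>w\<close>, then both \<open>x\<close> and the child of \<open>w\<close>
  on the path to \<open>x\<close> are moved, and these vertices are distinct for distinct \<open>w\<close>.\<close>

lemma card_blocked_le:
  assumes inv: "packing p m i" and im: "i < m" "m < t"
  defines "b \<equiv> f (v i) (v m)"
  defines "B \<equiv> {w \<in> V - C - moved p m. nb b w \<notin> C \<and> nb b w \<in> below (p m) w}"
  shows "2 * card B \<le> card (moved p m)"
proof -
  have it: "i < t" using im by simp
  note I = packing_dest[OF inv]
  have v_eq: "v k = v l \<longleftrightarrow> k = l" if "k < t" "l < t" for k l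
    using v_inj that by (auto simp: inj_on_def)
  have bS: "b \<in> S" using f_in C_V[OF it] C_V[OF im(2)] v_eq[OF it im(2)] im by (auto simp: b_def)
  have rr: "rooted V (v m) (p m)" and rb: "inj_on (\<lambda>z. f z (p m z)) (V - {v m})"
    using I(1) im by (auto simp: rainbow_rooted_def)
  have pvi: "p m (v i) = v m" using I(5) im it by auto
  have pV: "a \<in> V \<Longrightarrow> p m a \<in> V" for a using rr by (auto simp: rooted_def)
  have pr: "p m (v m) = v m" using rr by (auto simp: rooted_def)
  have pw: "p m w = v m" if "w \<in> B" for w using that by (auto simp: B_def moved_def)
  have xV: "nb b w \<in> V" "nb b w \<notin> C" "nb b w \<noteq> w" "f (nb b w) w = b" if "w \<in> B" for w
    using that nb_in[OF bS] nb_neq[OF bS] f_nb[OF bS] f_sym by (auto simp: B_def)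
  have wm: "w \<noteq> v m" if "w \<in> B" for w using that C_in[OF im(2)] by (auto simp: B_def)
  \<comment> \<open>Otherwise the tree at \<open>v m\<close> would contain colour \<open>b\<close>
    twice, since its edge from \<open>v i\<close> to \<open>v m\<close> is still in place.\<close>
  have px: "p m (nb b w) \<noteq> w" if "w \<in> B" for w
  proof
    assume "p m (nb b w) = w"
    then have "f (nb b w) (p m (nb b w)) = f (v i) (p m (v i))"
      using xV[OF that] pvi by (simp add: b_def)
    then have "nb b w = v i"
      using xV[OF that] C_V[OF it] C_in[OF im(2)] v_eq[OF it im(2)] im
      by (intro inj_onD[OF rb]) auto
    then show False using xV[OF that] C_in[OF it] by simp
  qed
  \<comment> \<open>Climb from \<open>nb b w\<close> to \<open>w\<close>: the path stays outside
    \<open>C\<close>, because a centre as parent would be the root, and its last vertex before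
    \<open>w\<close> is moved.\<close>
  have child: "\<exists>h \<in> moved p m. p m h = w" if "w \<in> B" for w
  proof -
    have "a \<in> V - C \<Longrightarrow> a \<noteq> w \<Longrightarrow> \<exists>h \<in> moved p m. p m h = w" if "a \<in> below (p m) w" for a
      using that
    proof (induction rule: below.induct)
      case base then show ?case by simp
    next
      case (step a)
      show ?case
      proof (cases "p m a = w")
        case True
        then have "a \<in> moved p m" using step.prems wm[OF \<open>w \<in> B\<close>] by (auto simp: moved_def)
        with True show ?thesis by blast
      next
        case False
        have "p m a \<notin> C"
        proof
          assume "p m a \<in> C"
          then have "p m a = v m" using parent_in_C[OF inv im(2)] step.prems by blast
          then have "v m \<in> below (p m) w" using step.hyps by simp
          then show False using below_fixpoint pr wm[OF \<open>w \<in> B\<close>] by metis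
        qed
        then show ?thesis using step False pV by blast
      qed
    qed
    from this[of "nb b w"] show ?thesis using that xV[OF that] by (auto simp: B_def)
  qed
  then obtain h where h: "\<And>w. w \<in> B \<Longrightarrow> h w \<in> moved p m" "\<And>w. w \<in> B \<Longrightarrow> p m (h w) = w"
    by metis
  have uniq: "w = w'" if "w \<in> B" "w' \<in> B" "a \<in> below (p m) w" "a \<in> below (p m) w'" for a w w'
    using below_child_unique[of a "p m" w w' "v m"] that pw pr wm by auto
  have xL: "nb b w \<in> moved p m" if "w \<in> B" for w
  proof (rule ccontr)
    assume "nb b w \<notin> moved p m"
    then have "p m (nb b w) = v m" using xV[OF that] by (auto simp: moved_def)
    moreover have "nb b w \<noteq> v m" using xV[OF that] C_in[OF im(2)] by auto
    ultimately have "nb b w = w"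
      using below_child_unique[of "nb b w" "p m" "nb b w" w "v m"] pw[OF that] pr wm[OF that] that
      by (auto simp: B_def intro: below.base)
    then show False using xV[OF that] by simp
  qed
  have fin: "finite B" using finite_V by (auto simp: B_def)
  have "inj_on (nb b) B"
    by (rule inj_on_inverseI[of B "nb b"]) (simp add: B_def nb_nb bS)
  moreover have "inj_on h B" by (intro inj_onI) (metis h(2))
  moreover have "nb b ` B \<inter> h ` B = {}"
  proof (rule ccontr)
    assume "nb b ` B \<inter> h ` B \<noteq> {}"
    then obtain w w' where w: "w \<in> B" "w' \<in> B" "nb b w = h w'" by blast
    have "h w' \<in> below (p m) w'" using h(2)[OF w(2)] below.intros by metis
    moreover have "h w' \<in> below (p m) w" using w by (auto simp: B_def)
    ultimately have "w = w'" using uniq w by blast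
    then show False using px[OF w(1)] w h(2) by simp
  qed
  ultimately have "card (nb b ` B \<union> h ` B) = 2 * card B"
    using fin by (simp add: card_Un_disjoint card_image)
  moreover have "nb b ` B \<union> h ` B \<subseteq> moved p m" using xL h(1) by blast
  ultimately show ?thesis using card_mono[OF finite_moved] by metis
qed

end

section \<open>Numerical estimates\<close>

lemma card_UN_le_mult:
  assumes "finite A" "\<And>k. k \<in> A \<Longrightarrow> card (F k) \<le> c"
  shows "card (\<Union>k\<in>A. F k) \<le> card A * c"
proof -
  have "card (\<Union>k\<in>A. F k) \<le> (\<Sum>k\<in>A. card (F k))" by (rule card_UN_le[OF assms(1)])
  also have "\<dots> \<le> of_nat (card A) * c" by (rule sum_bounded_above) (rule assms(2))
  finally show ?thesis by simp
qed

lemma card_ordered_pairs_le: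
  assumes "finite K" "\<And>k. k \<in> K \<Longrightarrow> finite (A k)"
  shows "card (\<Union>k\<in>K. (\<lambda>l. (l, q k l)) ` A k \<union> (\<lambda>l. (q k l, l)) ` A k) \<le> 2 * (\<Sum>k\<in>K. card (A k))"
proof -
  have "card (\<Union>k\<in>K. (\<lambda>l. (l, q k l)) ` A k \<union> (\<lambda>l. (q k l, l)) ` A k)
      \<le> (\<Sum>k\<in>K. card ((\<lambda>l. (l, q k l)) ` A k \<union> (\<lambda>l. (q k l, l)) ` A k))"
    by (rule card_UN_le[OF assms(1)])
  also have "\<dots> \<le> (\<Sum>k\<in>K. 2 * card (A k))"
  proof (rule sum_mono)
    fix k assume "k \<in> K"
    then show "card ((\<lambda>l. (l, q k l)) ` A k \<union> (\<lambda>l. (q k l, l)) ` A k) \<le> 2 * card (A k)"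
      using card_Un_le[of "(\<lambda>l. (l, q k l)) ` A k" "(\<lambda>l. (q k l, l)) ` A k"]
        card_image_le[OF assms(2), of k "\<lambda>l. (l, q k l)"]
        card_image_le[OF assms(2), of k "\<lambda>l. (q k l, l)"] by linarith
  qed
  finally show ?thesis by (simp add: sum_distrib_left)
qed

text \<open>\<open>U\<close> counts the admissible \<open>u\<close>, \<open>SU\<close> the pairs
  left by the conditions on \<open>u\<close> and on \<open>y\<close> given \<open>u\<close>, and
  \<open>G\<close> bounds the remaining bad pairs. In the reals \<open>a\<close> is a lower bound
  for \<open>2 * U\<close> and \<open>b\<close> one for the number of \<open>y\<close> per
  \<open>u\<close>. Thus \<open>2 * SU\<close> is at least about \<open>15 * T * T\<close>, against
  \<open>12 * T * T\<close> for \<open>2 * G\<close>.\<close>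

lemma switch_arith:
  fixes N T m i li lm w7 U SU G \<Sigma> :: nat
  assumes "9 * T + 46 \<le> N" "i < m" "m < T"
    and "li \<le> 2 * m - 2 - i" "lm \<le> i" "2 * w7 \<le> lm"
    and "N \<le> U + (T + li + (T + T + lm + w7 + 2 * (T - 2)))"
    and "2 * \<Sigma> \<le> 3 * m * (m - 1) + 6 * i" "G \<le> 4 * \<Sigma> + 3 * li"
    and "U * (N - (3 * T + li)) \<le> SU"
  shows "G < SU"
proof -
  define a b where "a = 4 * real T - real i + 108" and "b = 4 * real T + real i + 50"
  have m: "real m \<le> real T - 1" using assms(3) by linarith
  have li: "real li \<le> 2 * real m - 2 - real i" using assms(2,4) by linarith
  have ab: "0 \<le> a" "0 \<le> b" using assms(2,3) by (auto simp: a_def b_def)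
  have "real N \<le> real U + (3 * real T + real li + real lm + real w7 + 2 * (real T - 2))"
  proof -
    have "real (T - 2) = real T - 2" using assms(2,3) by (simp add: of_nat_diff)
    moreover have "real N \<le> real (U + (T + li + (T + T + lm + w7 + 2 * (T - 2))))"
      using assms(7) by (simp only: of_nat_le_iff)
    ultimately show ?thesis by simp
  qed
  moreover have N: "9 * real T + 46 \<le> real N" using assms(1) by linarith
  moreover have "real lm \<le> real i" "2 * real w7 \<le> real lm" using assms(5,6) by linarith+
  ultimately have aU: "a \<le> 2 * real U" using li m unfolding a_def by (simp add: algebra_simps)
  have "real (N - (3 * T + li)) \<ge> real N - 3 * real T - real li" by linarith
  then have "b \<le> real (N - (3 * T + li))" using N li m unfolding b_def by linarith
  with aU ab have "a * b \<le> 2 * real U * real (N - (3 * T + li))" by (intro mult_mono) auto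
  also have "\<dots> = 2 * real (U * (N - (3 * T + li)))" by simp
  also have "\<dots> \<le> 2 * real SU" using assms(10) by (simp only: of_nat_le_iff mult_le_cancel_left) simp
  finally have SU: "a * b \<le> 2 * real SU" .
  have "real (3 * m * (m - 1)) = 3 * real m * (real m - 1)" using assms(2) by (cases m) auto
  then have "2 * real \<Sigma> \<le> 3 * real m * (real m - 1) + 6 * real i"
    using assms(8) by (metis (mono_tags, opaque_lifting) of_nat_add of_nat_le_iff of_nat_mult of_nat_numeral)
  moreover have "real m * (real m - 1) \<le> real T * real T" using m assms(2) by (intro mult_mono) auto
  ultimately have "2 * real \<Sigma> \<le> 3 * (real T * real T) + 6 * real T" using assms(2,3) by auto
  moreover have "real G \<le> 4 * real \<Sigma> + 3 * real li" using assms(9) by linarith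
  ultimately have "2 * real G \<le> 12 * (real T * real T) + 36 * real T" using li m by linarith
  moreover have "a * b = 16 * (real T * real T) - real i * real i + 632 * real T + 58 * real i + 5400"
    by (simp add: a_def b_def algebra_simps)
  moreover have "real i * real i \<le> real T * real T" using assms(2,3) by (intro mult_mono) auto
  moreover have "0 \<le> real T * real T" by simp
  ultimately have "2 * real G < 2 * real SU" using SU by linarith
  then show ?thesis by simp
qed

context centres
begin

lemma switch_exists:
  assumes inv: "packing p m i" and im: "i < m" "m < t" and big: "9 * t + 46 \<le> card V"
  shows "\<exists>u w x y x' z. switch p m i u w x y x' z"
proof -
  have it: "i < t" using im by simp
  note I = packing_dest[OF inv]
  have v_eq: "v k = v l \<longleftrightarrow> k = l" if "k < t" "l < t" for k l
    using v_inj that by (auto simp: inj_on_def)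
  have cC: "card C = t" using card_image[OF v_inj] by simp
  have vV: "v i \<in> V" "v m \<in> V" using C_V it im by auto
  have vC: "v i \<in> C" "v m \<in> C" using C_in it im by auto
  have vim: "v i \<noteq> v m" using v_eq it im by auto
  define b where "b = f (v i) (v m)"
  have bS: "b \<in> S" using f_in vV vim by (simp add: b_def)
  \<comment> \<open>\<open>W\<close> collects the forbidden \<open>w\<close>, and \<open>g\<close> recovers \<open>u\<close> from \<open>w\<close>. Outer edges of colour \<open>b\<close>
    number at most one per tree, and neither of the trees at \<open>v i\<close>, \<open>v m\<close> has any, since there
    the colour is taken by \<open>{v i, v m}\<close>.\<close>
  define g where "g w = nb (f (v m) w) (v i)" for w
  define K where "K = {..<t} - {i, m}"
  define M where "M k = {l \<in> moved p k. f l (p k l) = b}" for k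
  define D where "D = (\<Union>k\<in>K. \<Union>l\<in>M k. {l, p k l})"
  define B where "B = {w \<in> V - C - moved p m. nb b w \<notin> C \<and> nb b w \<in> below (p m) w}"
  \<comment> \<open>The five parts exclude in turn: \<open>w\<close> a centre, \<open>x\<close> a
    centre, \<open>w\<close> moved, \<open>x\<close> below \<open>w\<close>, and
    \<open>{w, x}\<close> an outer edge of a third tree.\<close>
  define W where "W = C \<union> nb b ` C \<union> moved p m \<union> B \<union> D"
  define U where "U = V - (C \<union> moved p i \<union> g ` W)"
  \<comment> \<open>The last two sets exclude the \<open>y\<close> for which \<open>z\<close> or
    \<open>x'\<close> would be a centre.\<close>
  define SU where "SU = Sigma U (\<lambda>u. V - (C \<union> moved p i \<union> nb (f (v i) u) ` C \<union> (\<lambda>s. nb (f u s) (v i)) ` C))"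
  \<comment> \<open>The remaining conflicts concern \<open>u\<close> and \<open>y\<close> jointly and form the set \<open>G\<close>: an oriented
    outer edge, or a moved vertex lying in the wrong subtree, determines the whole pair.\<close>
  define E where "E = (\<Union>k\<in>{..<t} - {i}. (\<lambda>l. (l, p k l)) ` moved p k \<union> (\<lambda>l. (p k l, l)) ` moved p k)"
  \<comment> \<open>The unmoved child of the root above \<open>s\<close>; it is unique because
    subtrees at distinct children of the root are disjoint.\<close>
  define anc where "anc s = (SOME a. a \<in> V - C - moved p i \<and> s \<in> below (p i) a)" for s
  \<comment> \<open>The five parts stand for: \<open>{u, x'}\<close> in \<open>E\<close>,
    \<open>{y, z}\<close> in \<open>E\<close>, \<open>x'\<close> below \<open>u\<close>,
    \<open>z\<close> below \<open>y\<close>, and \<open>z\<close> below \<open>u\<close>. In the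
    last three \<open>s\<close> is the vertex lying too low.\<close>
  define G where "G = (\<lambda>(s, r). (s, nb (f s r) (v i))) ` E \<union> (\<lambda>(y, z). (nb (f y z) (v i), y)) ` E
     \<union> (\<lambda>s. (anc s, nb (f (anc s) s) (v i))) ` moved p i \<union> (\<lambda>s. (nb (f (anc s) s) (v i), anc s)) ` moved p i
     \<union> (\<lambda>s. (anc s, nb (f (v i) (anc s)) s)) ` moved p i"
  have finB: "finite B" using finite_V by (simp add: B_def)
  have finM: "finite (M k)" for k using finite_moved by (simp add: M_def)
  have finD: "finite D" using finM by (auto simp: D_def K_def)
  have finW: "finite W" using finite_moved finB finD by (simp add: W_def)
  have finE: "finite E" using finite_moved by (auto simp: E_def)

  \<comment> \<open>Counting the forbidden choices\<close>
  have cM: "card (M k) \<le> 1" if "k \<in> K" for k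
  proof -
    have kt: "k < t" using that by (simp add: K_def)
    have "inj_on (\<lambda>z. f z (p k z)) (V - {v k})"
      using I(1) kt by (auto simp: rainbow_rooted_def)
    moreover have "M k \<subseteq> V - {v k}" using C_in[OF kt] by (auto simp: M_def moved_def)
    ultimately have "inj_on (\<lambda>z. f z (p k z)) (M k)" by (rule inj_on_subset)
    moreover have "(\<lambda>z. f z (p k z)) ` M k \<subseteq> {b}" by (auto simp: M_def)
    ultimately show ?thesis using card_inj_on_le[of "\<lambda>z. f z (p k z)" "M k" "{b}"] by simp
  qed
  have cD: "card D \<le> 2 * (t - 2)"
  proof -
    have "card D \<le> card K * 2" unfolding D_def
    proof (rule card_UN_le_mult)
      fix k assume k: "k \<in> K"
      have "card (\<Union>l\<in>M k. {l, p k l}) \<le> card (M k) * 2"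
        by (rule card_UN_le_mult[OF finM]) (simp add: card_insert_if)
      with cM[OF k] show "card (\<Union>l\<in>M k. {l, p k l}) \<le> 2" by linarith
    qed (simp add: K_def)
    moreover have "card K = t - 2" using it im by (simp add: K_def card_Diff_subset)
    ultimately show ?thesis by simp
  qed
  have cW: "card W \<le> t + t + card (moved p m) + card B + 2 * (t - 2)"
  proof -
    have "card (nb b ` C) \<le> t" using card_image_le[of C "nb b"] cC by simp
    moreover have "card W \<le> card C + card (nb b ` C) + card (moved p m) + card B + card D"
      unfolding W_def by (meson add_le_mono1 card_Un_le le_trans)
    ultimately show ?thesis using cC cD by linarith
  qed
  have cU: "card V \<le> card U + (t + card (moved p i) + (t + t + card (moved p m) + card B + 2 * (t - 2)))"
  proof -
    have "card (C \<union> moved p i \<union> g ` W) \<le> card C + card (moved p i) + card (g ` W)"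
      by (meson add_le_mono1 card_Un_le le_trans)
    moreover have "card V - card (C \<union> moved p i \<union> g ` W) \<le> card U"
      unfolding U_def by (rule diff_card_le_card_Diff) (simp add: finite_moved finW)
    ultimately show ?thesis using cC cW card_image_le[OF finW, of g] by linarith
  qed
  have cSU: "card U * (card V - (3 * t + card (moved p i))) \<le> card SU"
  proof -
    have "card V - (3 * t + card (moved p i))
        \<le> card (V - (C \<union> moved p i \<union> nb (f (v i) u) ` C \<union> (\<lambda>s. nb (f u s) (v i)) ` C))" for u
    proof -
      let ?X = "C \<union> moved p i \<union> nb (f (v i) u) ` C \<union> (\<lambda>s. nb (f u s) (v i)) ` C"
      have "card ?X \<le> card C + card (moved p i) + card (nb (f (v i) u) ` C) + card ((\<lambda>s. nb (f u s) (v i)) ` C)"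
        by (meson add_le_mono1 card_Un_le le_trans)
      moreover have "card (nb (f (v i) u) ` C) \<le> t" "card ((\<lambda>s. nb (f u s) (v i)) ` C) \<le> t"
        using card_image_le[of C] cC by (metis finite_imageI finite_lessThan)+
      moreover have "card V - card ?X \<le> card (V - ?X)"
        by (rule diff_card_le_card_Diff) (simp add: finite_moved)
      ultimately show ?thesis using cC by linarith
    qed
    then have "(\<Sum>u\<in>U. card V - (3 * t + card (moved p i)))
        \<le> (\<Sum>u\<in>U. card (V - (C \<union> moved p i \<union> nb (f (v i) u) ` C \<union> (\<lambda>s. nb (f u s) (v i)) ` C)))"
      by (intro sum_mono)
    also have "\<dots> = card SU"
      using finite_V unfolding SU_def by (subst card_SigmaI) (simp_all add: U_def)
    finally show ?thesis by simp
  qed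
  have cE: "card E \<le> 2 * (\<Sum>k<t. card (moved p k))"
  proof -
    have "card E \<le> 2 * (\<Sum>k\<in>{..<t} - {i}. card (moved p k))"
      unfolding E_def by (rule card_ordered_pairs_le) (auto simp: finite_moved)
    moreover have "(\<Sum>k\<in>{..<t} - {i}. card (moved p k)) \<le> (\<Sum>k<t. card (moved p k))"
      by (rule sum_mono2) auto
    ultimately show ?thesis by linarith
  qed
  have cG: "card G \<le> 4 * (\<Sum>k<t. card (moved p k)) + 3 * card (moved p i)"
  proof -
    have un: "card (A1 \<union> A2 \<union> A3 \<union> A4 \<union> A5) \<le> card A1 + card A2 + card A3 + card A4 + card A5"
      for A1 A2 A3 A4 A5 :: "('a \<times> 'a) set"
      by (meson add_le_mono1 card_Un_le le_trans)
    have im: "card (h ` E) \<le> card E" "card (h' ` moved p i) \<le> card (moved p i)"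
      for h :: "'a \<times> 'a \<Rightarrow> 'a \<times> 'a" and h' :: "'a \<Rightarrow> 'a \<times> 'a"
      by (simp_all add: card_image_le finE finite_moved)
    show ?thesis unfolding G_def
      by (rule order.trans[OF un], rule order.trans[OF add_mono[OF add_mono[OF add_mono[OF add_mono[OF
          im(1) im(1)] im(2)] im(2)] im(2)]]) (use cE in linarith)
  qed
  have "card G < card SU"
  proof (rule switch_arith[OF big im _ _ _ cU _ cG cSU])
    show "card (moved p i) \<le> 2 * m - 2 - i" using I(2)[rule_format, OF it] im by (simp add: moved_bound_def)
    show "card (moved p m) \<le> i" using I(2)[rule_format, OF im(2)] im by (simp add: moved_bound_def)
    show "2 * card B \<le> card (moved p m)" using card_blocked_le[OF inv im] by (simp add: B_def b_def)
    have "(\<Sum>k<t. card (moved p k)) \<le> (\<Sum>k<t. moved_bound m i k)" using I(2) by (intro sum_mono) simp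
    then show "2 * (\<Sum>k<t. card (moved p k)) \<le> 3 * m * (m - 1) + 6 * i"
      using sum_moved_bound[of i m] im by linarith
  qed
  moreover have "finite G" using finE finite_moved by (auto simp: G_def)
  ultimately have "\<not> SU \<subseteq> G" using card_mono by (meson not_le)
  then obtain u y where uy: "(u, y) \<in> SU" "(u, y) \<notin> G" by auto

  \<comment> \<open>The surviving pair yields a switch\<close>
  have u: "u \<in> V" "u \<notin> C" "u \<notin> moved p i" "u \<notin> g ` W" using uy(1) by (auto simp: SU_def U_def)
  have y: "y \<in> V" "y \<notin> C" "y \<notin> moved p i" "y \<notin> nb (f (v i) u) ` C" "y \<notin> (\<lambda>s. nb (f u s) (v i)) ` C"
    using uy(1) by (auto simp: SU_def)
  have uy_ne: "u \<noteq> v i" "y \<noteq> v i" using u y vC by auto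
  define a where "a = f (v i) u"
  define d where "d = f (v i) y"
  define w where "w = nb a (v m)"
  define x where "x = nb b w"
  define x' where "x' = nb d u"
  define z where "z = nb a y"
  have aS: "a \<in> S" and dS: "d \<in> S" using f_in u y vV uy_ne by (auto simp: a_def d_def)
  have w: "w \<in> V" "w \<noteq> v m" "f (v m) w = a"
    using nb_in nb_neq f_nb aS vV by (auto simp: w_def)
  have "g w = u" using w(3) nb_f[of "v i" u] vV u uy_ne by (simp add: g_def a_def)
  then have "w \<notin> W" using u(4) by blast
  then have wW: "w \<notin> C" "w \<notin> nb b ` C" "w \<notin> moved p m" "w \<notin> B" "w \<notin> D" by (auto simp: W_def)
  have x: "x \<in> V" "f w x = b" using nb_in f_nb bS w by (auto simp: x_def)
  have "nb b x = w" using nb_nb bS w by (simp add: x_def)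
  then have xC: "x \<notin> C" using wW(2) by auto
  have xb: "x \<notin> below (p m) w" using wW w xC by (auto simp: B_def x_def)
  have x': "x' \<in> V" "x' \<noteq> u" "f u x' = d" using nb_in nb_neq f_nb dS u by (auto simp: x'_def)
  have ux'y: "nb (f u x') (v i) = y" using x' nb_f[of "v i" y] vV y uy_ne by (simp add: d_def)
  then have x'C: "x' \<notin> C" using y(5) by auto
  have z: "z \<in> V" "z \<noteq> y" "f y z = a" using nb_in nb_neq f_nb aS y by (auto simp: z_def)
  have "nb a z = y" using nb_nb aS y by (simp add: z_def)
  then have zC: "z \<notin> C" using y(4) by (auto simp: a_def)
  have yzu: "nb (f y z) (v i) = u" using z nb_f[of "v i" u] vV u uy_ne by (simp add: a_def)
  have pvi: "p i (v i) = v i" using I(1) it by (auto simp: rainbow_rooted_def rooted_def)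
  have root_child: "p i s = v i" "s \<noteq> v i" if "s \<in> V - C - moved p i" for s
    using that vC by (auto simp: moved_def)
  have uniq: "c = c'" if "c \<in> V - C - moved p i" "c' \<in> V - C - moved p i" "s \<in> below (p i) c" "s \<in> below (p i) c'" for c c' s
    using below_child_unique[OF that(3,4) _ _ pvi] root_child[OF that(1)] root_child[OF that(2)] by blast
  have anc: "anc s = c" if "c \<in> V - C - moved p i" "s \<in> below (p i) c" for c s
    unfolding anc_def by (rule some_equality) (use that uniq in blast)+
  have in_L: "s \<in> moved p i" if "s \<in> below (p i) c" "c \<in> V - C - moved p i" "s \<in> V" "s \<notin> C" "s \<noteq> c" for s c
    using uniq[of s c s] that below.base[of s "p i"] by blast
  have GL: "(anc s, nb (f (anc s) s) (v i)) \<in> G" "(nb (f (anc s) s) (v i), anc s) \<in> G"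
    "(anc s, nb (f (v i) (anc s)) s) \<in> G" if "s \<in> moved p i" for s
    unfolding G_def using that by (simp_all only: Un_iff image_eqI simp_thms)
  have GE: "(s, nb (f s r) (v i)) \<in> G" "(nb (f s r) (v i), s) \<in> G" if "(s, r) \<in> E" for s r
    unfolding G_def using imageI[OF that, of "\<lambda>(s, r). (s, nb (f s r) (v i))"]
      imageI[OF that, of "\<lambda>(y, z). (nb (f y z) (v i), y)"] by simp_all
  have x'b: "x' \<notin> below (p i) u"
  proof
    assume *: "x' \<in> below (p i) u"
    have "anc x' = u" "x' \<in> moved p i" using anc[OF _ *] in_L[OF *] u x' x'C by auto
    then show False using GL(1)[of x'] ux'y uy(2) by simp
  qed
  have zy: "z \<notin> below (p i) y"
  proof
    assume *: "z \<in> below (p i) y"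
    have "anc z = y" "z \<in> moved p i" using anc[OF _ *] in_L[OF *] y z zC by auto
    then show False using GL(2)[of z] yzu uy(2) by simp
  qed
  \<comment> \<open>\<open>in_L\<close> covers only vertices strictly below \<open>u\<close>;
    equality is excluded by the colours at \<open>u\<close>.\<close>
  have zu: "z \<noteq> u"
  proof
    assume "z = u"
    then have "f u y = f u (v i)" using z(3) f_sym[of u y] f_sym[of u "v i"] by (simp add: a_def)
    then show False using f_inj[of u y "v i"] u y vV uy_ne z(2) \<open>z = u\<close> by auto
  qed
  have zbu: "z \<notin> below (p i) u"
  proof
    assume *: "z \<in> below (p i) u"
    have "anc z = u" "z \<in> moved p i" using anc[OF _ *] in_L[OF *] u z zC zu by auto
    then show False using GL(3)[of z] \<open>nb a z = y\<close> uy(2) by (simp add: a_def)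
  qed
  have wx: "{w, x} \<noteq> {l, p k l}" if "k < t" "k \<noteq> m" "l \<in> moved p k" for k l
  proof
    assume eq: "{w, x} = {l, p k l}"
    then have fb: "f l (p k l) = b" using x(2) f_sym by (auto simp: doubleton_eq_iff)
    show False
    proof (cases "k = i")
      case True
      have "f (v m) (p i (v m)) = b" using I(5) im it f_sym by (auto simp: b_def)
      then have "l = v m"
        using I(1) it fb True that(3) vV vim vC
        by (intro inj_onD[of "\<lambda>z. f z (p i z)" "V - {v i}" l]) (auto simp: rainbow_rooted_def moved_def)
      then show False using that(3) vC by (simp add: moved_def)
    next
      case False
      then have "w \<in> D" using that fb eq by (auto simp: D_def K_def M_def)
      then show False using wW by simp
    qed
  qed
  have inE: "(s, r) \<in> E" if "k < t" "k \<noteq> i" "l \<in> moved p k" "{s, r} = {l, p k l}" for s r k l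
  proof -
    have "(l, p k l) \<in> E" "(p k l, l) \<in> E" using that(1-3) unfolding E_def by blast+
    then show ?thesis using that(4) by (auto simp: doubleton_eq_iff)
  qed
  have ux': "{u, x'} \<noteq> {l, p k l}" if "k < t" "k \<noteq> i" "l \<in> moved p k" for k l
  proof
    assume eq: "{u, x'} = {l, p k l}"
    show False using GE(1)[OF inE[OF that eq]] ux'y uy(2) by simp
  qed
  have yz: "{y, z} \<noteq> {l, p k l}" if "k < t" "k \<noteq> i" "l \<in> moved p k" for k l
  proof
    assume eq: "{y, z} = {l, p k l}"
    show False using GE(2)[OF inE[OF that eq]] yzu uy(2) by simp
  qed
  have "switch p m i u w x y x' z"
    unfolding switch_def
  proof (intro conjI)
    show "{u, w, x, y, x', z} \<subseteq> V - C" using u w wW x xC y x' x'C z zC by simp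
    show "f (v i) u = f (v m) w" "f w x = f (v i) (v m)" "f u x' = f (v i) y" "f y z = f (v i) u"
      using w x x' z by (simp_all add: a_def b_def d_def)
  qed (use u y wW xb x'b zy zbu wx ux' yz in simp_all)
  then show ?thesis by blast
qed

end

section \<open>Packing the trees\<close>

context centres
begin

lemma packing_star: "packing (\<lambda>k z. v k) 0 0"
proof -
  have "rainbow_rooted (v k) (\<lambda>z. v k)" if "k < t" for k
  proof -
    have "z \<in> below (\<lambda>z. v k) (v k)" for z by (rule below.step, rule below.base)
    moreover have "inj_on (\<lambda>z. f (v k) z) (V - {v k})"
      using f_inj[of "v k"] C_V[OF that] by (intro inj_onI) blast
    then have "inj_on (\<lambda>z. f z (v k)) (V - {v k})" by (simp only: f_sym[of _ "v k"])
    ultimately show ?thesis using C_V[OF that] by (auto simp: rainbow_rooted_def rooted_def)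
  qed
  then show ?thesis using v_inj by (simp add: packing_def moved_def)
qed

text \<open>A completed round \<open>m\<close> and the start of round \<open>Suc m\<close> describe
  the same treated pairs and the same bounds.\<close>

lemma packing_next:
  assumes "packing p m m"
  shows "packing p (Suc m) 0"
proof -
  have "moved_bound m m k = moved_bound (Suc m) 0 k" for k by (auto simp: moved_bound_def)
  moreover have "k < m \<or> k = m \<and> l < m \<longleftrightarrow> k < Suc m \<or> k = Suc m \<and> l < 0" if "l < k" for k l
    using that by auto
  ultimately show ?thesis using assms by (simp add: packing_def cong: conj_cong)
qed

lemma packing_exists:
  assumes "9 * t + 46 \<le> card V"
  shows "\<exists>p. packing p t 0"
proof -
  have "m \<le> t \<Longrightarrow> \<exists>p. packing p m 0" for m
  proof (induction m)
    case 0
    show ?case using packing_star by blast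
  next
    case (Suc m)
    have "i \<le> m \<Longrightarrow> \<exists>p. packing p m i" for i
    proof (induction i)
      case 0
      then show ?case using Suc by simp
    next
      case (Suc i)
      then obtain p where "packing p m i" by auto
      moreover have "i < m" "m < t" using Suc \<open>Suc m \<le> t\<close> by simp_all
      moreover from calculation obtain u w x y x' z where "switch p m i u w x y x' z"
        using switch_exists[OF _ _ _ assms] by blast
      ultimately show ?case by (rule packing_switch)
    qed
    then show ?case using packing_next by blast
  qed
  then show ?thesis by blast
qed

text \<open>Two outer edges differ by the invariant. Otherwise a centre is involved: the tree at
  \<open>v k\<close> keeps the edge to \<open>v k'\<close>, while the edge by which the other tree
  attaches \<open>v k\<close> leads to a vertex moved in the tree at \<open>v k\<close>.\<close>

lemma packing_edge_disjoint:
  assumes inv: "packing p t 0" and k: "k < k'" "k' < t"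
  shows "tree_edges V (v k) (p k) \<inter> tree_edges V (v k') (p k') = {}"
proof (rule ccontr)
  assume "tree_edges V (v k) (p k) \<inter> tree_edges V (v k') (p k') \<noteq> {}"
  then obtain z z' where z: "z \<in> V" "z \<noteq> v k" "z' \<in> V" "z' \<noteq> v k'"
    and eq: "{z, p k z} = {z', p k' z'}" by (auto simp: tree_edges_def)
  note I = packing_dest[OF inv]
  have kt: "k < t" using k by simp
  have v_eq: "v k = v l \<longleftrightarrow> k = l" if "k < t" "l < t" for k l
    using v_inj that by (auto simp: inj_on_def)
  have Ldisj: "\<not> (z \<in> moved p k \<and> z' \<in> moved p k')" using I(7) kt k eq by blast
  have out: "p j s \<notin> C" if "j < t" "s \<in> moved p j" for j s using I(3) that by blast
  have star: "p j s = v j" if "s \<in> V" "s \<notin> C" "s \<notin> moved p j" for j s using that by (auto simp: moved_def)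
  have lent: "p j (v l) \<in> moved p l" if "l < j" "j < t" for j l using I(4) that by auto
  have kept: "p j (v l) = v j" if "j < l" "l < t" for j l using I(5) that by auto
  have LC: "s \<notin> C" if "s \<in> moved p j" for s j using that by (simp add: moved_def)
  have "z = z' \<and> p k z = p k' z' \<or> z = p k' z' \<and> z' = p k z"
    using eq unfolding doubleton_eq_iff by metis
  then consider "z = z'" "p k z = p k' z" | "p k' z' = z" "p k z = z'" by metis
  then show False
  proof cases
    case 1
    show False
    proof (cases "z \<in> C")
      case True
      then obtain l where l: "l < t" "z = v l" by blast
      then have "inj_on (\<lambda>j. p j (v l)) {..<t}" using I(6) by simp
      from inj_onD[OF this, of k k'] show False using 1 l kt k by simp
    next
      case False
      show False
      proof (cases "z \<in> moved p k")
        case True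
        then have "p k' z = v k'" using star z(1) False Ldisj 1(1) by blast
        then show False using out[OF kt True] 1(2) C_in[OF k(2)] \<open>z = z'\<close> by simp
      next
        case nL: False
        then have "p k z = v k" using star z(1) False by blast
        then have "p k' z = v k" using 1 by simp
        then have "p k' z = v k'" using parent_in_C[OF inv k(2) z(1)] C_in[OF kt] by simp
        then show False using \<open>p k' z = v k\<close> v_eq[OF kt k(2)] k by simp
      qed
    qed
  next
    case 2
    show False
    proof (cases "z \<in> C")
      case True
      then obtain l where l: "l < t" "z = v l" by blast
      then consider "l < k" | "k < l" using z by (cases l k rule: linorder_cases) auto
      then show False
      proof cases
        case 1
        have "z = v k'" using parent_in_C[OF inv k(2) z(3)] \<open>p k' z' = z\<close> True by simp
        then show False using 1 l v_eq k by auto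
      next
        case 2
        then have "z' = v k" using kept l \<open>p k z = z'\<close> by simp
        then have "z \<in> moved p k" using lent[OF k] \<open>p k' z' = z\<close> by simp
        then show False using LC True by blast
      qed
    next
      case False
      show False
      proof (cases "z \<in> moved p k")
        case True
        then have "z' \<notin> C" using out[OF kt True] 2(2) by simp
        moreover have "p k' z' \<noteq> v k'" using False 2 C_in[OF k(2)] by auto
        ultimately have "z' \<in> moved p k'" using z(3) by (simp add: moved_def)
        then show False using Ldisj True by simp
      next
        case nL: False
        then have "z' = v k" using star[OF z(1) False nL] 2(2) by simp
        then show False using lent[OF k] 2(1) nL by simp
      qed
    qed
  qed
qed

end

section \<open>From the colouring to perfect matchings\<close>

lemma factorization_of_colouring:
  assumes "complete_graph n G" "proper_edge_colouring G c" "card (c ` edges G) = n - 1"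
  shows "factorization (verts G) (\<lambda>x y. c {x, y}) (c ` edges G)
           (\<lambda>a x. THE y. y \<in> verts G \<and> y \<noteq> x \<and> c {x, y} = a)"
proof -
  let ?V = "verts G" and ?S = "c ` edges G"
  have "simple_graph G" and n: "card ?V = n" and E: "edges G = {e. e \<subseteq> ?V \<and> card e = 2}"
    using assms(1) by (auto simp: complete_graph_def)
  then have fin: "finite ?V" by (simp add: simple_graph_def)
  have "edges G \<subseteq> Pow ?V" by (auto simp: E)
  then have "finite (edges G)" using fin finite_subset by blast
  then have finS: "finite ?S" by simp
  have edge: "{x, y} \<in> edges G" if "x \<in> ?V" "y \<in> ?V" "x \<noteq> y" for x y
    using that by (auto simp: E)
  have inj: "inj_on (\<lambda>y. c {x, y}) (?V - {x})" if "x \<in> ?V" for x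
  proof (rule inj_onI, rule ccontr)
    fix y y' assume y: "y \<in> ?V - {x}" "y' \<in> ?V - {x}" "c {x, y} = c {x, y'}" "y \<noteq> y'"
    then have "{x, y} \<noteq> {x, y'}" by (auto simp: doubleton_eq_iff)
    moreover have "{x, y} \<in> edges G" "{x, y'} \<in> edges G" using y edge that by auto
    ultimately have "c {x, y} \<noteq> c {x, y'}"
      using assms(2)[unfolded proper_edge_colouring_def, rule_format, of "{x, y}" "{x, y'}"] by blast
    then show False using y(3) by simp
  qed
  \<comment> \<open>The \<open>n - 1\<close> edges at \<open>x\<close> have distinct colours and
    only \<open>n - 1\<close> colours exist, so each colour occurs at \<open>x\<close>.\<close>
  have surj: "(\<lambda>y. c {x, y}) ` (?V - {x}) = ?S" if "x \<in> ?V" for x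
  proof (rule card_subset_eq[OF finS])
    show "(\<lambda>y. c {x, y}) ` (?V - {x}) \<subseteq> ?S" using edge that by blast
    show "card ((\<lambda>y. c {x, y}) ` (?V - {x})) = card ?S"
      using card_image[OF inj[OF that]] that fin n assms(3) by simp
  qed
  have nb: "(THE y. y \<in> ?V \<and> y \<noteq> x \<and> c {x, y} = a) = y"
    if "x \<in> ?V" "y \<in> ?V" "y \<noteq> x" "c {x, y} = a" for x y a
    using that inj[OF that(1)] by (intro the_equality) (auto simp: inj_on_def)
  have the: "(THE y. y \<in> ?V \<and> y \<noteq> x \<and> c {x, y} = a) \<in> ?V
      \<and> (THE y. y \<in> ?V \<and> y \<noteq> x \<and> c {x, y} = a) \<noteq> x
      \<and> c {x, THE y. y \<in> ?V \<and> y \<noteq> x \<and> c {x, y} = a} = a"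
    if "a \<in> ?S" "x \<in> ?V" for a x
  proof -
    have "a \<in> (\<lambda>y. c {x, y}) ` (?V - {x})" using surj[OF that(2)] that(1) by simp
    then obtain y where "y \<in> ?V" "y \<noteq> x" "c {x, y} = a" by blast
    then show ?thesis using nb[OF that(2), of y a] by simp
  qed
  show ?thesis
  proof
    show "finite ?V" by (rule fin)
    show "c {x, y} = c {y, x}" for x y by (simp add: insert_commute)
    show "c {x, y} \<in> ?S" if "x \<in> ?V" "y \<in> ?V" "x \<noteq> y" for x y using edge that by blast
    show "(THE y'. y' \<in> ?V \<and> y' \<noteq> x \<and> c {x, y'} = c {x, y}) = y"
      if "x \<in> ?V" "y \<in> ?V" "x \<noteq> y" for x y using nb that by auto
  qed (simp_all add: the)
qed

theorem theorem5:
  fixes n :: nat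
    and G :: "'a ugraph"
    and c :: "'a set \<Rightarrow> 'c"
  assumes "n > 0"
    and "complete_graph n G"
    and "proper_edge_colouring G c"
    and "card (c ` edges G) = n - 1"
  shows "\<exists>\<T>. finite \<T> \<and>
           (\<forall>T \<in> \<T>. spanning_subgraph T G \<and> tree T \<and> rainbow c T) \<and>
           pairwise edge_disjoint \<T> \<and>
           real (card \<T>) \<ge> real n / 9 - 6"
proof (cases "n \<le> 54")
  case True
  \<comment> \<open>The required number is at most 0 here, so the empty family suffices.\<close>
  then show ?thesis by (intro exI[of _ "{}"]) (auto simp: pairwise_def)
next
  case False
  let ?V = "verts G"
  have n: "card ?V = n" and simple: "simple_graph G" and E: "edges G = {e. e \<subseteq> ?V \<and> card e = 2}"
    using assms(2) by (auto simp: complete_graph_def)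
  \<comment> \<open>Rounding up costs at most 8 in \<open>9 * t\<close>, which turns the 54 in
    \<open>n - 54\<close> into 46.\<close>
  define t where "t = nat \<lceil>real n / 9 - 6\<rceil>"
  have t: "real n / 9 - 6 \<le> real t" "9 * t + 46 \<le> n" using False unfolding t_def by linarith+
  then have "t \<le> card ?V" using n by simp
  then obtain C where C: "C \<subseteq> ?V" "card C = t" "finite C" by (rule obtain_subset_with_card_n)
  then obtain v where "bij_betw v {0..<t} C" using ex_bij_betw_nat_finite by blast
  then have v: "inj_on v {..<t}" "v ` {..<t} = C" by (auto simp: bij_betw_def atLeast0LessThan)
  interpret factorization ?V "\<lambda>x y. c {x, y}" "c ` edges G"
    "\<lambda>a x. THE y. y \<in> ?V \<and> y \<noteq> x \<and> c {x, y} = a"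
    by (rule factorization_of_colouring[OF assms(2-4)])
  interpret centres ?V "\<lambda>x y. c {x, y}" "c ` edges G"
    "\<lambda>a x. THE y. y \<in> ?V \<and> y \<noteq> x \<and> c {x, y} = a" v t
    by unfold_locales (use v C in auto)
  obtain p where p: "packing p t 0" using packing_exists t(2) n by auto
  define F where "F k = tree_edges ?V (v k) (p k)" for k
  define T where "T k = UGraph ?V (F k)" for k
  have rr: "rooted ?V (v k) (p k)" "inj_on (\<lambda>z. c {z, p k z}) (?V - {v k})" if "k < t" for k
    using packing_dest(1)[OF p] that by (auto simp: rainbow_rooted_def)
  have disj: "F k \<inter> F k' = {}" if "k < t" "k' < t" "k \<noteq> k'" for k k'
    using packing_edge_disjoint[OF p] that unfolding F_def by (metis Int_commute linorder_neqE_nat)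
  \<comment> \<open>Disjoint nonempty edge sets are distinct, so the family really has
    \<open>t\<close> members.\<close>
  have nonempty: "F k \<noteq> {}" if "k < t" for k
  proof -
    have "card (?V - {v k}) \<noteq> 0" using False n finite_V C_V[OF that] by simp
    then have "?V - {v k} \<noteq> {}" by (metis card.empty)
    then show ?thesis by (simp add: F_def tree_edges_def)
  qed
  have "inj_on T {..<t}"
    by (intro inj_onI) (metis T_def disj nonempty Int_absorb lessThan_iff ugraph.inject)
  then have "card (T ` {..<t}) = t" by (simp add: card_image)
  moreover have "spanning_subgraph (T k) G \<and> tree (T k) \<and> rainbow c (T k)" if "k < t" for k
  proof (intro conjI)
    have s: "simple_graph (T k)"
      unfolding T_def F_def by (rule tree_edges_simple[OF rr(1)[OF that] finite_V])
    then have "F k \<subseteq> edges G" by (auto simp: E simple_graph_def T_def)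
    with s simple show "spanning_subgraph (T k) G"
      by (simp add: spanning_subgraph_def subgraph_def T_def)
    show "tree (T k)" unfolding T_def F_def by (rule tree_edges_tree[OF rr(1)[OF that] finite_V])
    have "inj_on c (F k)"
      unfolding F_def tree_edges_def using rr(2)[OF that] by (auto simp: inj_on_def)
    then show "rainbow c (T k)" by (simp add: rainbow_def T_def)
  qed
  moreover have "pairwise edge_disjoint (T ` {..<t})"
    using disj by (auto simp: pairwise_def edge_disjoint_def T_def)
  ultimately show ?thesis using t(1) by (intro exI[of _ "T ` {..<t}"]) auto
qed

end
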